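(* Let $a$ and $a'$ be two symmetric, uniformly elliptic conductivity matrices on $\Omega$ with $L^\infty(\Omega)$ entries, and let $V$ and $V'$ be finite-dimensional subspaces of $H^1_0(\Omega)$. For $f\in L^2(\Omega)$ let $u\in H^1_0(\Omega)$ be the weak solution of $-\operatorname{div}(a\nabla u)=f$ in $\Omega$, $u=0$ on $\partial\Omega$, and let $u'\in H^1_0(\Omega)$ be the weak solution of $-\operatorname{div}(a'\nabla u')=f$ in $\Omega$, $u'=0$ on $\partial\Omega$. If $(\operatorname{div} a\nabla V)=(\operatorname{div} a'\nabla V')$ as subspaces of $H^{-1}(\Omega)$, then $$\sup_{f\in L^2(\Omega)}\ \inf_{v\in V}\frac{\|u-v\|_{a\text{-flux}}}{\|f\|_{L^2(\Omega)}}=\sup_{f\in L^2(\Omega)}\ \inf_{v\in V'}\frac{\|u'-v\|_{a'\text{-flux}}}{\|f\|_{L^2(\Omega)}},$$ where the suprema are over $f\neq 0$.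
   Context: $\Omega\subset\mathbb{R}^d$ ($d\ge 2$) is a bounded domain with $C^2$ boundary. A conductivity matrix $a=(a_{ij})$ has $a_{ij}\in L^\infty(\Omega)$, is symmetric, and is uniformly elliptic: there are constants $0<\lambda_{\min}(a)\le\lambda_{\max}(a)<\infty$ with $\lambda_{\min}(a)|\xi|^2\le\xi^Ta(x)\xi\le\lambda_{\max}(a)|\xi|^2$ for all $\xi\in\mathbb{R}^d$ and (almost) all $x\in\Omega$; similarly for $a'$. For $k\in(L^2(\Omega))^d$, $k_{pot}$ denotes the $L^2$-orthogonal projection of $k$ onto the closure of $\{\nabla g: g\in C_0^\infty(\Omega)\}$ in $(L^2(\Omega))^d$. For $\psi\in H^1_0(\Omega)$, $\|\psi\|_{a\text{-flux}}:=\|(a\nabla\psi)_{pot}\|_{(L^2(\Omega))^d}$, and similarly with $a'$. For a finite-dimensional subspace $V\subset H^1_0(\Omega)$, $(\operatorname{div} a\nabla V):=\operatorname{span}\{\operatorname{div}(a\nabla v): v\in V\}\subset H^{-1}(\Omega)$. *)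

theory Defs
  imports "HOL-Analysis.Analysis" "HOL-Library.Function_Algebras"
begin

text \<open>
  Elements of \<open>L\<^sup>2(\<Omega>)\<close>, \<open>H\<^sup>1(\<Omega>)\<close>, \<dots> are represented by functions on the whole space;
  all notions below depend only on the values almost everywhere in \<open>\<Omega>\<close>.
\<close>

instantiation "fun" :: (type, real_vector) real_vector
begin

definition scaleR_fun :: "real \<Rightarrow> ('a \<Rightarrow> 'b) \<Rightarrow> 'a \<Rightarrow> 'b"
  where "scaleR_fun c f = (\<lambda>x. c *\<^sub>R f x)"

instance
  by standard (auto simp: scaleR_fun_def fun_eq_iff scaleR_right_distrib scaleR_left_distrib)

end

definition grad :: "(real ^ 'n \<Rightarrow> real) \<Rightarrow> real ^ 'n \<Rightarrow> real ^ 'n"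
  where "grad g x = (\<chi> i. frechet_derivative g (at x) (axis i 1))"

fun C_k :: "nat \<Rightarrow> (real ^ 'n \<Rightarrow> real) \<Rightarrow> bool" where
  "C_k 0 g \<longleftrightarrow> continuous_on UNIV g"
| "C_k (Suc k) g \<longleftrightarrow> g differentiable_on UNIV \<and> (\<forall>i. C_k k (\<lambda>x. grad g x $ i))"

definition test_functions :: "(real ^ 'n) set \<Rightarrow> (real ^ 'n \<Rightarrow> real) set"
  where "test_functions \<Omega> =
    {g. (\<forall>k. C_k k g) \<and> compact (closure {x. g x \<noteq> 0}) \<and> closure {x. g x \<noteq> 0} \<subseteq> \<Omega>}"

text \<open>
  Near each boundary point, \<open>\<Omega>\<close> is the region above the graph of a \<open>C\<^sup>2\<close> function over a
  hyperplane with unit normal \<open>\<nu>\<close>. The function on the hyperplane is given as the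
  restriction of a \<open>C\<^sup>2\<close> function on the whole space, \<open>x - (x \<bullet> \<nu>) *\<^sub>R \<nu>\<close> being
  the orthogonal projection of \<open>x\<close> to the hyperplane.
\<close>

definition C2_boundary :: "(real ^ 'n) set \<Rightarrow> bool"
  where "C2_boundary \<Omega> \<longleftrightarrow>
    (\<forall>x0 \<in> frontier \<Omega>. \<exists>r > 0. \<exists>\<nu> \<gamma>. norm \<nu> = 1 \<and> C_k 2 \<gamma> \<and>
       \<Omega> \<inter> ball x0 r = {x \<in> ball x0 r. x \<bullet> \<nu> > \<gamma> (x - (x \<bullet> \<nu>) *\<^sub>R \<nu>)})"

definition bounded_C2_domain :: "(real ^ 'n) set \<Rightarrow> bool"
  where "bounded_C2_domain \<Omega> \<longleftrightarrow>
    open \<Omega> \<and> connected \<Omega> \<and> \<Omega> \<noteq> {} \<and> bounded \<Omega> \<and> C2_boundary \<Omega>"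

definition conductivity :: "(real ^ 'n) set \<Rightarrow> (real ^ 'n \<Rightarrow> real ^ 'n ^ 'n) \<Rightarrow> bool"
  where "conductivity \<Omega> a \<longleftrightarrow>
    (\<forall>i j. (\<lambda>x. a x $ i $ j) \<in> borel_measurable (lebesgue_on \<Omega>) \<and>
           (\<exists>C. AE x in lebesgue_on \<Omega>. \<bar>a x $ i $ j\<bar> \<le> C)) \<and>
    (AE x in lebesgue_on \<Omega>. transpose (a x) = a x) \<and>
    (\<exists>lmin lmax. 0 < lmin \<and> lmin \<le> lmax \<and>
       (AE x in lebesgue_on \<Omega>. \<forall>\<xi>.
          lmin * (norm \<xi>)\<^sup>2 \<le> \<xi> \<bullet> (a x *v \<xi>) \<and> \<xi> \<bullet> (a x *v \<xi>) \<le> lmax * (norm \<xi>)\<^sup>2))"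

definition L2 :: "(real ^ 'n) set \<Rightarrow> (real ^ 'n \<Rightarrow> 'b::euclidean_space) set"
  where "L2 \<Omega> = {f \<in> borel_measurable (lebesgue_on \<Omega>).
    integrable (lebesgue_on \<Omega>) (\<lambda>x. (norm (f x))\<^sup>2)}"

definition L2norm :: "(real ^ 'n) set \<Rightarrow> (real ^ 'n \<Rightarrow> 'b::euclidean_space) \<Rightarrow> real"
  where "L2norm \<Omega> f = sqrt (LINT x|lebesgue_on \<Omega>. (norm (f x))\<^sup>2)"

definition has_weak_gradient ::
    "(real ^ 'n) set \<Rightarrow> (real ^ 'n \<Rightarrow> real) \<Rightarrow> (real ^ 'n \<Rightarrow> real ^ 'n) \<Rightarrow> bool"
  where "has_weak_gradient \<Omega> u G \<longleftrightarrow> u \<in> L2 \<Omega> \<and> G \<in> L2 \<Omega> \<and>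
    (\<forall>\<phi> \<in> test_functions \<Omega>. \<forall>i.
       (LINT x|lebesgue_on \<Omega>. u x * grad \<phi> x $ i) = - (LINT x|lebesgue_on \<Omega>. G x $ i * \<phi> x))"

definition H1 :: "(real ^ 'n) set \<Rightarrow> (real ^ 'n \<Rightarrow> real) set"
  where "H1 \<Omega> = {u. \<exists>G. has_weak_gradient \<Omega> u G}"

text \<open>The weak gradient of \<open>u \<in> H\<^sup>1(\<Omega>)\<close> is unique up to null sets.\<close>

definition wgrad :: "(real ^ 'n) set \<Rightarrow> (real ^ 'n \<Rightarrow> real) \<Rightarrow> real ^ 'n \<Rightarrow> real ^ 'n"
  where "wgrad \<Omega> u = (SOME G. has_weak_gradient \<Omega> u G)"

definition H1norm :: "(real ^ 'n) set \<Rightarrow> (real ^ 'n \<Rightarrow> real) \<Rightarrow> real"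
  where "H1norm \<Omega> u = sqrt ((L2norm \<Omega> u)\<^sup>2 + (L2norm \<Omega> (wgrad \<Omega> u))\<^sup>2)"

definition H10 :: "(real ^ 'n) set \<Rightarrow> (real ^ 'n \<Rightarrow> real) set"
  where "H10 \<Omega> = {u \<in> H1 \<Omega>. \<forall>e > 0. \<exists>\<phi> \<in> test_functions \<Omega>. H1norm \<Omega> (u - \<phi>) < e}"

definition findim_subspace_H10 :: "(real ^ 'n) set \<Rightarrow> (real ^ 'n \<Rightarrow> real) set \<Rightarrow> bool"
  where "findim_subspace_H10 \<Omega> V \<longleftrightarrow> subspace V \<and> V \<subseteq> H10 \<Omega> \<and>
    (\<exists>B. finite B \<and> B \<subseteq> V \<and> (\<forall>v \<in> V. \<exists>w \<in> span B. AE x in lebesgue_on \<Omega>. v x = w x))"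

definition flux ::
    "(real ^ 'n) set \<Rightarrow> (real ^ 'n \<Rightarrow> real ^ 'n ^ 'n) \<Rightarrow> (real ^ 'n \<Rightarrow> real) \<Rightarrow> real ^ 'n \<Rightarrow> real ^ 'n"
  where "flux \<Omega> a v = (\<lambda>x. a x *v wgrad \<Omega> v x)"

text \<open>
  \<open>div (a \<nabla> v)\<close> as an element of \<open>H\<^sup>-\<^sup>1(\<Omega>)\<close>, the dual of \<open>H\<^sup>1\<^sub>0(\<Omega>)\<close>. Functionals on
  \<open>H\<^sup>1\<^sub>0(\<Omega>)\<close> are extended by zero to all functions, so that they agree on
  \<open>H\<^sup>1\<^sub>0(\<Omega>)\<close> iff they are equal in HOL.
\<close>

definition div_flux ::
    "(real ^ 'n) set \<Rightarrow> (real ^ 'n \<Rightarrow> real ^ 'n ^ 'n) \<Rightarrow> (real ^ 'n \<Rightarrow> real) \<Rightarrow>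
     (real ^ 'n \<Rightarrow> real) \<Rightarrow> real"
  where "div_flux \<Omega> a v = (\<lambda>\<phi>. if \<phi> \<in> H10 \<Omega>
    then - (LINT x|lebesgue_on \<Omega>. flux \<Omega> a v x \<bullet> wgrad \<Omega> \<phi> x) else 0)"

definition div_space ::
    "(real ^ 'n) set \<Rightarrow> (real ^ 'n \<Rightarrow> real ^ 'n ^ 'n) \<Rightarrow> (real ^ 'n \<Rightarrow> real) set \<Rightarrow>
     ((real ^ 'n \<Rightarrow> real) \<Rightarrow> real) set"
  where "div_space \<Omega> a V = span (div_flux \<Omega> a ` V)"

definition weak_solution ::
    "(real ^ 'n) set \<Rightarrow> (real ^ 'n \<Rightarrow> real ^ 'n ^ 'n) \<Rightarrow> (real ^ 'n \<Rightarrow> real) \<Rightarrow>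
     (real ^ 'n \<Rightarrow> real) \<Rightarrow> bool"
  where "weak_solution \<Omega> a f u \<longleftrightarrow> u \<in> H10 \<Omega> \<and>
    (\<forall>\<phi> \<in> H10 \<Omega>. (LINT x|lebesgue_on \<Omega>. flux \<Omega> a u x \<bullet> wgrad \<Omega> \<phi> x) =
                 (LINT x|lebesgue_on \<Omega>. f x * \<phi> x))"

definition L2pot :: "(real ^ 'n) set \<Rightarrow> (real ^ 'n \<Rightarrow> real ^ 'n) set"
  where "L2pot \<Omega> = {p \<in> L2 \<Omega>. \<forall>e > 0. \<exists>g \<in> test_functions \<Omega>. L2norm \<Omega> (p - grad g) < e}"

text \<open>The orthogonal projection of \<open>k \<in> L\<^sup>2\<close> to the closed subspace \<open>L2pot\<close>, unique up to null sets.\<close>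

definition pot :: "(real ^ 'n) set \<Rightarrow> (real ^ 'n \<Rightarrow> real ^ 'n) \<Rightarrow> real ^ 'n \<Rightarrow> real ^ 'n"
  where "pot \<Omega> k = (SOME p. p \<in> L2pot \<Omega> \<and>
    (\<forall>q \<in> L2pot \<Omega>. (LINT x|lebesgue_on \<Omega>. (k x - p x) \<bullet> q x) = 0))"

definition flux_norm ::
    "(real ^ 'n) set \<Rightarrow> (real ^ 'n \<Rightarrow> real ^ 'n ^ 'n) \<Rightarrow> (real ^ 'n \<Rightarrow> real) \<Rightarrow> real"
  where "flux_norm \<Omega> a \<psi> = L2norm \<Omega> (pot \<Omega> (flux \<Omega> a \<psi>))"

end

theory Submission
  imports Defs "HOL-Computational_Algebra.Polynomial"
begin

text \<open>
  The two quantities under the supremum already agree for each \<open>f\<close>. Given \<open>v \<in> V\<close>, choose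
  \<open>v' \<in> V'\<close> with \<open>div (a \<nabla>v) = div (a' \<nabla>v')\<close>. Then the fluxes \<open>a \<nabla>(u - v)\<close> and
  \<open>a' \<nabla>(u' - v')\<close> have the same divergence, so their difference is orthogonal to all gradients of
  test functions and hence to \<open>L2pot\<close>. The conditions that characterise their projections to
  \<open>L2pot\<close> therefore coincide, and neither existence nor uniqueness of the projection is needed.

  That \<open>div (a \<nabla>v)\<close> depends linearly on \<open>v\<close>, and that \<open>wgrad\<close> is the classical gradient on
  test functions, rests on the almost everywhere uniqueness of weak gradients. It follows from the
  fundamental lemma of the calculus of variations, applied to products of one-dimensional bump
  functions.
\<close>

section \<open>Smooth bump functions\<close>

lemma grad_eq:
  assumes "(g has_derivative D) (at x)"
  shows "grad g x $ i = D (axis i 1)"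
  using frechet_derivative_at[OF assms] by (simp add: grad_def)

lemma C_k_Suc_lower: "C_k (Suc k) g \<Longrightarrow> C_k k g"
proof (induction k arbitrary: g)
  case 0
  then show ?case by (simp add: differentiable_imp_continuous_on)
next
  case (Suc k)
  then show ?case by (metis C_k.simps(2))
qed

lemma C_k_const: "C_k k (\<lambda>x. c)"
proof (induction k arbitrary: c)
  case (Suc k)
  have "grad (\<lambda>x. c) x $ i = 0" for x and i :: 'a
    by (rule grad_eq) (rule has_derivative_const)
  with Suc show ?case by simp
qed simp

lemma C_k_add: "C_k k f \<Longrightarrow> C_k k g \<Longrightarrow> C_k k (\<lambda>x. f x + g x)"
proof (induction k arbitrary: f g)
  case 0
  then show ?case by (simp add: continuous_on_add)
next
  case (Suc k)
  have "grad (\<lambda>x. f x + g x) x $ i = grad f x $ i + grad g x $ i" for x i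
  proof -
    have "(f has_derivative frechet_derivative f (at x)) (at x)"
         "(g has_derivative frechet_derivative g (at x)) (at x)"
      using Suc.prems by (auto simp: differentiable_on_def frechet_derivative_works)
    from grad_eq[OF has_derivative_add[OF this]] show ?thesis by (simp add: grad_def)
  qed
  with Suc show ?case by (auto simp: differentiable_on_def)
qed

lemma grad_mult:
  assumes "f differentiable at x" "g differentiable at x"
  shows "grad (\<lambda>x. f x * g x) x $ i = f x * grad g x $ i + grad f x $ i * g x"
proof -
  have "(f has_derivative frechet_derivative f (at x)) (at x)"
       "(g has_derivative frechet_derivative g (at x)) (at x)"
    using assms by (auto simp: frechet_derivative_works)
  from grad_eq[OF has_derivative_mult[OF this]] show ?thesis
    by (simp add: grad_def)
qed

lemma C_k_mult: "C_k k f \<Longrightarrow> C_k k g \<Longrightarrow> C_k k (\<lambda>x. f x * g x)"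
proof (induction k arbitrary: f g)
  case 0
  then show ?case by (simp add: continuous_on_mult)
next
  case (Suc k)
  have "grad (\<lambda>x. f x * g x) x $ i = f x * grad g x $ i + grad f x $ i * g x" for x i
    using Suc.prems by (intro grad_mult) (auto simp: differentiable_on_def)
  \<comment> \<open>The product rule keeps one factor undifferentiated in each term, so the
    induction hypothesis has to be fed with \<open>f\<close> and \<open>g\<close> themselves at the
    lower order \<open>k\<close>.\<close>
  moreover have "C_k k f" "C_k k g" using Suc.prems by (blast intro: C_k_Suc_lower)+
  ultimately show ?case using Suc
    by (auto simp: differentiable_on_def intro!: C_k_add Suc.IH)
qed

lemma C_k_prod: "finite A \<Longrightarrow> (\<And>i. i \<in> A \<Longrightarrow> C_k k (f i)) \<Longrightarrow> C_k k (\<lambda>x. \<Prod>i\<in>A. f i x)"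
  by (induction A rule: finite_induct) (auto simp: C_k_const intro!: C_k_mult)

section \<open>The flat function exp(-1/t) and the bumps built from it\<close>

text \<open>\<open>flat 1\<close> is the classical smooth function exp(-1/t), continued by zero to t
  \<le> 0. The polynomial in 1/t makes the family closed under differentiation.\<close>

definition flat :: "real poly \<Rightarrow> real \<Rightarrow> real"
  where "flat P t = (if t \<le> 0 then 0 else poly P (1 / t) * exp (- (1 / t)))"

text \<open>The exponential outgrows every monomial. With y = 1/h this controls \<open>flat\<close>
  near the origin.\<close>

lemma poly_times_exp_tendsto_0: "((\<lambda>y::real. poly P y * exp (- y)) \<longlongrightarrow> 0) at_top"
proof -
  have "((\<lambda>y. \<Sum>i\<le>degree P. coeff P i * (y ^ i / exp y)) \<longlongrightarrow> (\<Sum>i\<le>degree P. coeff P i * 0)) at_top"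
    by (intro tendsto_sum tendsto_mult tendsto_const tendsto_power_div_exp_0)
  moreover have "poly P y * exp (- y) = (\<Sum>i\<le>degree P. coeff P i * (y ^ i / exp y))" for y
    by (simp add: poly_altdef exp_minus sum_distrib_right divide_inverse mult.assoc)
  ultimately show ?thesis by simp
qed

text \<open>For t > 0 the chain rule turns P(1/t) exp(-1/t) into (P - P')(1/t) exp(-1/t) / t^2, and
  \<open>[:0, 0, 1:]\<close> is the polynomial X^2 that absorbs the factor 1/t^2. Only the origin
  needs a limit argument.\<close>

lemma DERIV_flat: "(flat P has_field_derivative flat ([:0, 0, 1:] * (P - pderiv P)) t) (at t)"
proof -
  consider "t < 0" | "t > 0" | "t = 0" by linarith
  then show ?thesis
  proof cases
    case 1
    have "((\<lambda>_. 0) has_field_derivative 0) (at t)" by simp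
    moreover have "flat ([:0, 0, 1:] * (P - pderiv P)) t = 0" using 1 by (simp add: flat_def)
    moreover have "\<forall>\<^sub>F s in nhds t. 0 = flat P s"
      using eventually_nhds_in_open[of "{..<0}" t] 1
      by (auto elim!: eventually_mono simp: flat_def)
    ultimately show ?thesis
      using DERIV_cong_ev[of t t "\<lambda>_. 0" "flat P" 0 0] by simp
  next
    case 2
    have "((\<lambda>s. poly P (1 / s) * exp (- (1 / s))) has_field_derivative
        flat ([:0, 0, 1:] * (P - pderiv P)) t) (at t)"
      using 2 by (auto simp: flat_def intro!: derivative_eq_intros
          DERIV_chain'[where g="poly P" and f="\<lambda>s. 1/s", OF _ poly_DERIV])
         (simp add: field_simps power2_eq_square)
    moreover have ev: "\<forall>\<^sub>F s in nhds t. poly P (1 / s) * exp (- (1 / s)) = flat P s"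
      using eventually_nhds_in_open[of "{0<..}" t] 2
      by (auto elim!: eventually_mono simp: flat_def)
    ultimately show ?thesis
      using DERIV_cong_ev[OF refl ev refl] by simp
  next
    case 3
    have "((\<lambda>h. flat P h / h) \<longlongrightarrow> 0) (at_left 0)"
      by (rule tendsto_eventually) (auto simp: eventually_at_filter flat_def)
    moreover have "((\<lambda>h. flat P h / h) \<longlongrightarrow> 0) (at_right 0)"
    proof -
      \<comment> \<open>As \<open>flat P 0 = 0\<close>, the difference quotient at the origin is
        \<open>flat P h / h\<close>; the factor 1/h is absorbed by \<open>pCons 0 P\<close>, that
        is, by X times P.\<close>
      have "((\<lambda>h. poly (pCons 0 P) (inverse h) * exp (- inverse h)) \<longlongrightarrow> 0) (at_right 0)"
        using poly_times_exp_tendsto_0 filterlim_inverse_at_top_right by (rule filterlim_compose)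
      moreover have "\<forall>\<^sub>F h in at_right 0. poly (pCons 0 P) (inverse h) * exp (- inverse h) = flat P h / h"
        by (auto simp: eventually_at_filter flat_def field_simps)
      ultimately show ?thesis by (rule Lim_transform_eventually)
    qed
    ultimately have "((\<lambda>h. flat P h / h) \<longlongrightarrow> 0) (at 0)"
      by (rule filterlim_split_at)
    then show ?thesis using 3 by (simp add: DERIV_def flat_def)
  qed
qed

text \<open>Differentiating multiplies by a constant and replaces \<open>P\<close> by another
  polynomial, so the induction on \<open>k\<close> runs over all \<open>P\<close> at once. The
  affine argument covers both factors of \<open>bump\<close>, one increasing and one decreasing in
  the coordinate.\<close>

lemma C_k_flat: "C_k k (\<lambda>x. flat P (c * x $ i + d))"
proof (induction k arbitrary: P)
  case 0
  have "isCont (flat P) t" for t using DERIV_flat by (rule DERIV_isCont)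
  then have "continuous_on UNIV (flat P)" by (simp add: continuous_at_imp_continuous_on)
  then have "continuous_on UNIV (flat P \<circ> (\<lambda>x::real^'a. c * x $ i + d))"
    by (intro continuous_on_compose continuous_intros) (auto intro: continuous_on_subset)
  then show ?case by (simp add: o_def)
next
  case (Suc k)
  let ?Q = "[:0, 0, 1:] * (P - pderiv P)"
  have D: "((\<lambda>x::real^'a. flat P (c * x $ i + d)) has_derivative
      (\<lambda>h. flat ?Q (c * x $ i + d) * (c * h $ i))) (at x)" for x
  proof -
    have "((\<lambda>x::real^'a. c * x $ i + d) has_derivative (\<lambda>h. c * h $ i)) (at x)"
      by (auto intro!: derivative_eq_intros bounded_linear_imp_has_derivative
          bounded_linear_vec_nth bounded_linear_const_mult)
    moreover have "(flat P has_derivative (\<lambda>h. flat ?Q (c * x $ i + d) * h)) (at (c * x $ i + d))"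
      using DERIV_flat[of P] by (simp add: has_field_derivative_def)
    ultimately show ?thesis
      using has_derivative_compose by fastforce
  qed
  have "grad (\<lambda>x::real^'a. flat P (c * x $ i + d)) x $ j
      = flat ?Q (c * x $ i + d) * (c * (axis j 1 :: real^'a) $ i)" for x j
    using grad_eq[OF D] by simp
  then show ?case
    using D Suc[of ?Q] by (auto simp: differentiable_on_def differentiable_def intro!: C_k_mult C_k_const)
qed

text \<open>
  The factor \<open>Suc n\<close> turns \<open>exp (- 1 / t)\<close> into its \<open>n + 1\<close>-st root, so that \<open>bump a b n\<close> tends to
  the indicator of the box although its support does not depend on \<open>n\<close>.
\<close>

definition bump :: "real ^ 'n \<Rightarrow> real ^ 'n \<Rightarrow> nat \<Rightarrow> real ^ 'n \<Rightarrow> real"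
  where "bump a b n x = (\<Prod>i\<in>UNIV. flat 1 (real (Suc n) * (x $ i - a $ i)) * flat 1 (real (Suc n) * (b $ i - x $ i)))"

lemma C_k_bump: "C_k k (bump a b n)"
proof -
  have "bump a b n = (\<lambda>x. \<Prod>i\<in>UNIV. flat 1 (real (Suc n) * x $ i + (- real (Suc n) * a $ i))
      * flat 1 (- real (Suc n) * x $ i + real (Suc n) * b $ i))"
    by (rule ext) (simp add: bump_def algebra_simps)
  then show ?thesis by (auto intro!: C_k_prod C_k_mult C_k_flat)
qed

lemma flat_1_bounds: "0 \<le> flat 1 t" "flat 1 t \<le> 1"
  by (auto simp: flat_def)

lemma bump_bounds: "0 \<le> bump a b n x" "bump a b n x \<le> 1"
  unfolding bump_def by (auto intro!: prod_nonneg prod_le_1 mult_le_one simp: flat_1_bounds)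

lemma bump_outside: "x \<notin> box a b \<Longrightarrow> bump a b n x = 0"
proof -
  assume "x \<notin> box a b"
  then obtain i where "x $ i \<le> a $ i \<or> b $ i \<le> x $ i"
    by (auto simp: mem_box_cart not_less)
  then have "flat 1 (real (Suc n) * (x $ i - a $ i)) * flat 1 (real (Suc n) * (b $ i - x $ i)) = 0"
    by (auto simp: flat_def mult_le_0_iff)
  then show ?thesis unfolding bump_def by (subst prod_zero_iff) auto
qed

lemma bump_tendsto: "(\<lambda>n. bump a b n x) \<longlonglongrightarrow> indicator (box a b) x"
proof (cases "x \<in> box a b")
  case True
  have *: "(\<lambda>n. flat 1 (real (Suc n) * s)) \<longlonglongrightarrow> 1" if "s > 0" for s
  proof -
    have "(\<lambda>n. exp (- (inverse (real (Suc n)) * (1 / s)))) \<longlonglongrightarrow> exp (- (0 * (1 / s)))"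
      by (intro tendsto_intros LIMSEQ_inverse_real_of_nat)
    moreover have "flat 1 (real (Suc n) * s) = exp (- (inverse (real (Suc n)) * (1 / s)))" for n
      using that by (simp add: flat_def mult_le_0_iff divide_inverse)
    ultimately show ?thesis by simp
  qed
  have "(\<lambda>n. bump a b n x) \<longlonglongrightarrow> (\<Prod>i\<in>(UNIV::'a set). 1 * 1)"
    unfolding bump_def using True by (intro tendsto_prod tendsto_mult *) (auto simp: mem_box_cart)
  then show ?thesis using True by simp
next
  case False
  then show ?thesis by (simp add: bump_outside)
qed

text \<open>The closure of the open box where the bump can be nonzero lies in the closed box; this
  is why \<open>cbox a b\<close>, and not \<open>box a b\<close>, is asked to lie in
  \<Omega>.\<close>

lemma bump_test_function:
  assumes "cbox a b \<subseteq> \<Omega>"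
  shows "bump a b n \<in> test_functions \<Omega>"
proof -
  have "closure {x. bump a b n x \<noteq> 0} \<subseteq> cbox a b"
    using bump_outside box_subset_cbox by (intro closure_minimal) (blast intro: closed_cbox)+
  moreover from this have "compact (closure {x. bump a b n x \<noteq> 0})"
    using compact_cbox bounded_subset by (metis bounded_cbox closed_closure compact_eq_bounded_closed)
  ultimately show ?thesis using assms by (auto simp: test_functions_def C_k_bump)
qed

section \<open>The fundamental lemma of the calculus of variations\<close>

text \<open>Open boxes form an intersection-stable generator of the Borel sets. The sets over which
  \<open>h\<close> integrates to zero are closed under complements, thanks to \<open>total\<close>,
  and under countable disjoint unions, so they include all Borel sets; then the density
  \<open>h\<close> vanishes almost everywhere.\<close>

lemma AE_zero_of_box_integrals:
  fixes h :: "'a::euclidean_space \<Rightarrow> real"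
  assumes int: "integrable lborel h"
    and total: "integral\<^sup>L lborel h = 0"
    and box: "\<And>a b. (LINT x:box a b|lborel. h x) = 0"
  shows "AE x in lborel. h x = 0"
proof (rule sigma_finite_measure.density_zero[OF lborel.sigma_finite_measure_axioms int])
  fix A :: "'a set"
  assume "A \<in> sets lborel"
  then have A: "A \<in> sigma_sets UNIV (range (\<lambda>(a, b). box a b :: 'a set))"
    using arg_cong[OF borel_eq_box[where 'a='a], of sets] by simp
  have borelI: "B \<in> sets borel" if "B \<in> sigma_sets UNIV (range (\<lambda>(a, b). box a b :: 'a set))" for B
    using that arg_cong[OF borel_eq_box[where 'a='a], of sets] by simp
  have set_int: "set_integrable lborel B h" if "B \<in> sets borel" for B
    unfolding set_integrable_def using int that by (intro integrable_mult_indicator) auto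
  have "Int_stable (range (\<lambda>(a, b). box a b :: 'a set))"
    by (auto simp: Int_stable_def box_Int_box)
  then show "(LINT x:A|lborel. h x) = 0"
    using _ A
  proof (rule sigma_sets_induct_disjoint)
    fix B assume B: "B \<in> sigma_sets UNIV (range (\<lambda>(a, b). box a b :: 'a set))"
      and eq: "(LINT x:B|lborel. h x) = 0"
    have "(LINT x:B|lborel. h x) + (LINT x:(UNIV - B)|lborel. h x) = (LINT x:B \<union> (UNIV - B)|lborel. h x)"
      using borelI[OF B] by (intro set_integral_Un[symmetric] set_int) auto
    also have "\<dots> = 0" using total by (simp add: set_lebesgue_integral_def)
    finally show "(LINT x:(UNIV - B)|lborel. h x) = 0" using eq by simp
  next
    fix B :: "nat \<Rightarrow> 'a set"
    assume "disjoint_family B" and B: "range B \<subseteq> sigma_sets UNIV (range (\<lambda>(a, b). box a b :: 'a set))"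
      and eq: "\<And>i. (LINT x:B i|lborel. h x) = 0"
    have "B i \<in> sets borel" for i using B borelI by blast
    then have "(LINT x:(\<Union>i. B i)|lborel. h x) = (\<Sum>i. (LINT x:B i|lborel. h x))"
      using \<open>disjoint_family B\<close>
      by (intro lebesgue_integral_countable_add set_int) (auto simp: disjoint_family_on_def)
    then show "(LINT x:(\<Union>i. B i)|lborel. h x) = 0" by (simp add: eq)
  next
    show "(LINT x:{}|lborel. h x) = 0" by (simp add: set_lebesgue_integral_def)
  qed (auto simp: box)
qed

lemma continuous_measurable_lebesgue_on:
  fixes f :: "'a::euclidean_space \<Rightarrow> 'b::{second_countable_topology, topological_space}"
  assumes "continuous_on UNIV f"
  shows "f \<in> borel_measurable (lebesgue_on S)"
  using assms by (intro measurable_restrict_space1 measurable_completion) (simp add: borel_measurable_continuous_onI)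

lemma test_function_continuous: "\<phi> \<in> test_functions \<Omega> \<Longrightarrow> continuous_on UNIV \<phi>"
  unfolding test_functions_def by (metis (mono_tags, lifting) C_k.simps(1) mem_Collect_eq)

text \<open>Testing with bump functions shows that the integral of \<open>g\<close> vanishes on every box in \<open>\<Omega>\<close>.\<close>

lemma fundamental_lemma_of_variations:
  fixes \<Omega> :: "(real ^ 'n) set"
  assumes "open \<Omega>" and int: "integrable (lebesgue_on \<Omega>) g"
    and orth: "\<And>\<phi>. \<phi> \<in> test_functions \<Omega> \<Longrightarrow> (LINT x|lebesgue_on \<Omega>. g x * \<phi> x) = 0"
  shows "AE x in lebesgue_on \<Omega>. g x = 0"
proof -
  have \<Omega>: "\<Omega> \<inter> space lebesgue \<in> sets lebesgue" using \<open>open \<Omega>\<close> by auto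
  have box0: "(LINT x|lebesgue_on \<Omega>. g x * indicator (box a b) x) = 0" if "cbox a b \<subseteq> \<Omega>" for a b
  proof -
    \<comment> \<open>The bumps lie between 0 and 1 and tend to the indicator of the box, so
      \<bar>g\<bar> dominates the products.\<close>
    have lim: "(\<lambda>n. LINT x|lebesgue_on \<Omega>. g x * bump a b n x) \<longlonglongrightarrow> (LINT x|lebesgue_on \<Omega>. g x * indicator (box a b) x)"
    proof (rule integral_dominated_convergence[where w="\<lambda>x. \<bar>g x\<bar>"])
      show "(\<lambda>x. g x * indicator (box a b) x) \<in> borel_measurable (lebesgue_on \<Omega>)"
        using int by (intro borel_measurable_times measurable_restrict_space1[of "indicator (box a b)"])
          (auto intro!: borel_measurable_indicator)
      show "(\<lambda>x. g x * bump a b n x) \<in> borel_measurable (lebesgue_on \<Omega>)" for n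
        using int continuous_measurable_lebesgue_on[OF test_function_continuous[OF bump_test_function[OF that]]]
        by (intro borel_measurable_times) auto
      show "AE x in lebesgue_on \<Omega>. (\<lambda>n. g x * bump a b n x) \<longlonglongrightarrow> g x * indicator (box a b) x"
        by (intro AE_I2 tendsto_intros bump_tendsto)
      show "AE x in lebesgue_on \<Omega>. norm (g x * bump a b n x) \<le> \<bar>g x\<bar>" for n
      proof (intro AE_I2)
        show "norm (g x * bump a b n x) \<le> \<bar>g x\<bar>" for x
          using bump_bounds[of a b n x] by (simp add: abs_mult mult_left_le)
      qed
    qed (use int in auto)
    have "(\<lambda>n. LINT x|lebesgue_on \<Omega>. g x * bump a b n x) \<longlonglongrightarrow> 0"
      by (simp add: orth[OF bump_test_function[OF that]])
    then show ?thesis using lim LIMSEQ_unique by blast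
  qed
  have on_cbox: "AE x in lebesgue. x \<in> cbox c d \<longrightarrow> g x = 0" if cd: "cbox c d \<subseteq> \<Omega>" for c d
  proof -
    \<comment> \<open>Cutting \<open>g\<close> off by an open box lets arbitrary boxes be tested:
      their intersection with \<open>box c d\<close> is again a box, now inside \<Omega>.\<close>
    define h where "h x = indicator (box c d) x * (indicator \<Omega> x * g x)" for x
    have int_h: "integrable lebesgue h"
      unfolding h_def using int integrable_restrict_space[OF \<Omega>, of g]
        integrable_mult_indicator[of "box c d" lebesgue "\<lambda>x. indicator \<Omega> x * g x"] by simp
    \<comment> \<open>\<open>g\<close> is only Lebesgue measurable, while the Dynkin argument
      concerns \<open>lborel\<close>; a Borel representative of \<open>h\<close> bridges the
      two.\<close>
    then obtain h' where h'_meas: "h' \<in> borel_measurable lborel" and AE_h': "AE x in lborel. h x = h' x"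
      using completion_ex_borel_measurable_real[of h lborel] by auto
    have AE_h'': "AE x in lebesgue. h x = h' x" using AE_h' by (rule AE_completion)
    have h'_leb: "h' \<in> borel_measurable lebesgue"
      using h'_meas by (rule measurable_completion)
    have "integrable lebesgue h'"
      using int_h AE_h'' h'_leb by (subst integrable_cong_AE[symmetric]) auto
    then have int_h': "integrable lborel h'" using h'_meas by (simp add: integrable_completion)
    \<comment> \<open>Asking only that the trace of \<open>B\<close> on \<open>box c d\<close> be a
      box treats the whole space and all open boxes together.\<close>
    have sub0: "(LINT x:B|lborel. h' x) = 0" if B: "B \<in> sets borel" and "B \<inter> box c d = box e f" for B e f
    proof -
      have "(LINT x:B|lborel. h' x) = (LINT x|lebesgue. indicator B x * h' x)"
        unfolding set_lebesgue_integral_def using h'_meas B by (subst integral_completion) auto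
      also have "\<dots> = (LINT x|lebesgue. indicator B x * h x)"
      proof (rule integral_cong_AE)
        show "AE x in lebesgue. indicator B x * h' x = indicator B x * h x"
          using AE_h'' by eventually_elim simp
      qed (use h'_leb B int_h in \<open>auto intro!: borel_measurable_times borel_measurable_indicator\<close>)
      also have "\<dots> = (LINT x|lebesgue. indicator \<Omega> x *\<^sub>R (g x * indicator (box e f) x))"
        unfolding h_def that(2)[symmetric] indicator_inter_arith by (simp add: mult_ac)
      also have "\<dots> = (LINT x|lebesgue_on \<Omega>. g x * indicator (box e f) x)"
        using \<Omega> by (simp add: integral_restrict_space)
      also have "\<dots> = 0"
      proof (cases "box e f = {}")
        \<comment> \<open>The closure of a nonempty open box is its closed box, which therefore
          stays in \<open>cbox c d\<close>. If \<open>box e f\<close> is empty,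
          \<open>cbox e f\<close> may be a degenerate box leaving \<Omega>, but then the integrand
          is zero.\<close>
        case False
        then have "cbox e f = closure (B \<inter> box c d)" using that(2) by (simp add: closure_box)
        also have "\<dots> \<subseteq> cbox c d" using box_subset_cbox by (intro closure_minimal) (auto intro: closed_cbox)
        finally show ?thesis using cd by (intro box0) auto
      qed simp
      finally show ?thesis .
    qed
    have "AE x in lborel. h' x = 0"
    proof (rule AE_zero_of_box_integrals[OF int_h'])
      show "integral\<^sup>L lborel h' = 0" using sub0[of UNIV c d] by (simp add: set_lebesgue_integral_def)
      show "(LINT x:box a b|lborel. h' x) = 0" for a b
        by (rule sub0[OF _ box_Int_box]) simp
    qed
    then have "AE x in lebesgue. h' x = 0" by (rule AE_completion)
    \<comment> \<open>\<open>h\<close> sees only the open box; the faces of the closed one form a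
      null set.\<close>
    moreover have "AE x in lebesgue. x \<notin> cbox c d - box c d"
      using negligible_frontier_interval[of c d] unfolding negligible_iff_null_sets by (rule AE_not_in)
    ultimately show ?thesis using AE_h''
      by eventually_elim (use cd box_subset_cbox in \<open>auto simp: h_def subset_iff\<close>)
  qed
  \<comment> \<open>Countably many closed boxes exhaust \<Omega>, so their exceptional null sets add
    up to a null set.\<close>
  obtain \<D> where \<D>: "countable \<D>" "\<D> \<subseteq> Pow \<Omega>" "\<And>X. X \<in> \<D> \<Longrightarrow> \<exists>a b. X = cbox a b" "\<Union>\<D> = \<Omega>"
    using open_countable_Union_open_cbox[OF \<open>open \<Omega>\<close>] by metis
  have "AE x in lebesgue. x \<in> X \<longrightarrow> g x = 0" if "X \<in> \<D>" for X
  proof -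
    obtain a b where "X = cbox a b" using \<D>(3)[OF \<open>X \<in> \<D>\<close>] by blast
    moreover have "X \<subseteq> \<Omega>" using \<D>(2) that by blast
    ultimately show ?thesis using on_cbox by simp
  qed
  then have "AE x in lebesgue. \<forall>X\<in>\<D>. x \<in> X \<longrightarrow> g x = 0"
    using \<D>(1) by (intro AE_ball_countable') auto
  then have "AE x in lebesgue. x \<in> \<Omega> \<longrightarrow> g x = 0"
    by eventually_elim (use \<D>(4) in blast)
  then show ?thesis using AE_restrict_space_iff[OF \<Omega>] by blast
qed

section \<open>Integration by parts for test functions\<close>

lemma test_function_C_k: "\<phi> \<in> test_functions \<Omega> \<Longrightarrow> C_k k \<phi>"
  by (simp add: test_functions_def)

lemma test_function_differentiable: "\<phi> \<in> test_functions \<Omega> \<Longrightarrow> \<phi> differentiable at x"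
  using test_function_C_k[of \<phi> \<Omega> "Suc 0"] by (simp add: differentiable_on_def)

lemma test_function_grad_continuous: "\<phi> \<in> test_functions \<Omega> \<Longrightarrow> continuous_on UNIV (\<lambda>x. grad \<phi> x $ i)"
  using test_function_C_k[of \<phi> \<Omega> "Suc 0"] by simp

lemma test_function_outside: "\<phi> \<in> test_functions \<Omega> \<Longrightarrow> x \<notin> \<Omega> \<Longrightarrow> \<phi> x = 0"
  using closure_subset[of "{x. \<phi> x \<noteq> 0}"] by (auto simp: test_functions_def)

text \<open>
  The difference quotients of \<open>F\<close> have integral zero by translation invariance.
\<close>

lemma integral_grad_eq_0:
  fixes F :: "real ^ 'n \<Rightarrow> real"
  assumes diff: "\<And>x. F differentiable at x"
    and cont: "continuous_on UNIV (\<lambda>x. grad F x $ i)"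
    and "bounded S" and out: "\<And>x. x \<notin> S \<Longrightarrow> F x = 0"
  shows "(LINT x|lborel. grad F x $ i) = 0"
proof -
  let ?e = "axis i 1 :: real ^ 'n"
  define d where "d n = inverse (real (Suc n))" for n
  obtain R where R: "\<And>x. x \<in> S \<Longrightarrow> norm x \<le> R" using \<open>bounded S\<close> by (auto simp: bounded_iff)
  have contF: "continuous_on A F" for A
    using diff by (intro differentiable_imp_continuous_on) (simp add: differentiable_on_def differentiable_at_withinI)
  have D: "((\<lambda>t. F (x + t *\<^sub>R ?e)) has_field_derivative grad F (x + t *\<^sub>R ?e) $ i) (at t)" for x t
  proof -
    let ?D = "frechet_derivative F (at (x + t *\<^sub>R ?e))"
    have D: "(F has_derivative ?D) (at (x + t *\<^sub>R ?e))"
      using diff by (simp add: frechet_derivative_works)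
    moreover have "((\<lambda>t. x + t *\<^sub>R ?e) has_derivative (\<lambda>s. s *\<^sub>R ?e)) (at t)"
      using has_derivative_add[OF has_derivative_const has_derivative_scaleR_left[OF has_derivative_ident], of x ?e]
      by simp
    ultimately have "((\<lambda>t. F (x + t *\<^sub>R ?e)) has_derivative (\<lambda>s. ?D (s *\<^sub>R ?e))) (at t)"
      using has_derivative_compose by blast
    moreover have "?D (s *\<^sub>R ?e) = grad F (x + t *\<^sub>R ?e) $ i * s" for s
      using has_derivative_linear[OF D] by (simp add: grad_def linear_scale mult.commute)
    ultimately show ?thesis by (simp add: has_field_derivative_def)
  qed
  \<comment> \<open>The difference quotients will be supported in the ball of radius
    \<open>R + 1\<close>, and steps have length at most 1, so the intermediate points of the mean
    value theorem stay within radius \<open>R + 2\<close>.\<close>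
  have "compact ((\<lambda>x. grad F x $ i) ` cball 0 (R + 2))"
    using continuous_on_subset[OF cont subset_UNIV] compact_cball by (rule compact_continuous_image)
  from compact_imp_bounded[OF this] obtain B
    where "\<forall>y\<in>(\<lambda>x. grad F x $ i) ` cball 0 (R + 2). norm y \<le> B"
    unfolding bounded_iff by blast
  then have B: "\<bar>grad F x $ i\<bar> \<le> B" if "norm x \<le> R + 2" for x
    using that by simp
  define s where "s n x = (F (x + d n *\<^sub>R ?e) - F x) / d n" for n x
  have d: "0 < d n" "d n \<le> 1" for n
    using le_imp_inverse_le[of 1 "real (Suc n)"] by (simp_all add: d_def del: of_nat_Suc)
  \<comment> \<open>Inside radius \<open>R + 1\<close> the mean value theorem applies. Outside it,
    both \<open>x\<close> and the shifted point have norm above \<open>R\<close>, where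
    \<open>F\<close> is zero.\<close>
  have bound: "\<bar>s n x\<bar> \<le> indicator (cball 0 (R + 1)) x * B" for n x
  proof (cases "norm x \<le> R + 1")
    case True
    have "\<exists>t. 0 < t \<and> t < d n \<and>
        F (x + d n *\<^sub>R ?e) - F (x + 0 *\<^sub>R ?e) = (d n - 0) * grad F (x + t *\<^sub>R ?e) $ i"
      using d(1) by (rule MVT2) (rule D)
    then obtain t where t: "0 < t" "t < d n"
      "F (x + d n *\<^sub>R ?e) - F (x + 0 *\<^sub>R ?e) = (d n - 0) * grad F (x + t *\<^sub>R ?e) $ i"
      by blast
    have "norm (x + t *\<^sub>R ?e) \<le> R + 2"
      using True t(1,2) d(2)[of n] norm_triangle_ineq[of x "t *\<^sub>R ?e"] by simp
    moreover have "s n x = grad F (x + t *\<^sub>R ?e) $ i"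
      using t(3) d(1)[of n] unfolding s_def by simp
    ultimately show ?thesis using B True by simp
  next
    case False
    have "norm (x + d n *\<^sub>R ?e) > R"
      using False d[of n] norm_diff_ineq[of x "d n *\<^sub>R ?e"] by simp
    then have "x + d n *\<^sub>R ?e \<notin> S" using R[of "x + d n *\<^sub>R ?e"] by linarith
    moreover have "x \<notin> S" using R[of x] False by linarith
    ultimately have "s n x = 0" by (simp add: s_def out)
    then show ?thesis using False by simp
  qed
  have lim: "(\<lambda>n. s n x) \<longlonglongrightarrow> grad F x $ i" for x
  proof -
    have "((\<lambda>h. (F (x + h *\<^sub>R ?e) - F x) / h) \<longlongrightarrow> grad F x $ i) (at 0)"
      using D[of x 0] by (simp add: DERIV_def)
    \<comment> \<open>The limit defining the derivative leaves out step 0, so the steps have to be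
      nonzero as well as tend to 0.\<close>
    moreover have "filterlim d (at 0) sequentially"
      using LIMSEQ_inverse_real_of_nat d(1) unfolding filterlim_at d_def by (simp add: less_imp_neq[symmetric])
    ultimately show ?thesis unfolding s_def by (rule filterlim_compose)
  qed
  have intF: "integrable lborel F"
  proof -
    have "integrable lborel (\<lambda>x. indicator (cball 0 R) x *\<^sub>R F x)"
      by (rule borel_integrable_compact) (auto intro: contF)
    moreover have "indicator (cball 0 R) x *\<^sub>R F x = F x" for x
      using R[of x] out[of x] by (cases "x \<in> S") auto
    then have "(\<lambda>x. indicator (cball 0 R) x *\<^sub>R F x) = F" by blast
    ultimately show ?thesis by argo
  qed
  \<comment> \<open>Lebesgue measure is its own image under a translation.\<close>
  have shift: "integrable lborel (\<lambda>x. F (c + x))" "(LINT x|lborel. F (c + x)) = (LINT x|lborel. F x)" for c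
  proof -
    have F: "F \<in> borel_measurable borel" using contF by (rule borel_measurable_continuous_onI)
    have "integrable (distr lborel borel ((+) c)) F" by (subst lborel_distr_plus) (rule intF)
    then show "integrable lborel (\<lambda>x. F (c + x))" using F by (subst (asm) integrable_distr_eq) auto
    have "(LINT x|lborel. F x) = integral\<^sup>L (distr lborel borel ((+) c)) F" by (subst lborel_distr_plus) simp
    also have "\<dots> = (LINT x|lborel. F (c + x))" using F by (subst integral_distr) auto
    finally show "(LINT x|lborel. F (c + x)) = (LINT x|lborel. F x)" ..
  qed
  have "(\<lambda>n. LINT x|lborel. s n x) \<longlonglongrightarrow> (LINT x|lborel. grad F x $ i)"
  proof (rule integral_dominated_convergence)
    show "integrable lborel (\<lambda>x. indicator (cball 0 (R + 1)) x *\<^sub>R B)"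
      by (rule borel_integrable_compact) auto
    show "(\<lambda>x. grad F x $ i) \<in> borel_measurable lborel"
      using cont by (simp add: borel_measurable_continuous_onI)
    show "s n \<in> borel_measurable lborel" for n
      using shift(1)[of "d n *\<^sub>R ?e"] intF unfolding s_def by (auto simp: add.commute)
  qed (use bound lim in \<open>simp_all add: AE_I2\<close>)
  moreover have "(LINT x|lborel. s n x) = 0" for n
    using shift[of "d n *\<^sub>R ?e"] intF unfolding s_def by (simp add: add.commute)
  ultimately show ?thesis using LIMSEQ_unique[OF _ tendsto_const] by fastforce
qed

lemma continuous_integrable_lebesgue_on:
  fixes f :: "'a::euclidean_space \<Rightarrow> real"
  assumes "bounded \<Omega>" "open \<Omega>" and cont: "continuous_on UNIV f"
  shows "integrable (lebesgue_on \<Omega>) f"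
proof -
  interpret finite_measure "lebesgue_on \<Omega>"
    using assms by (simp add: finite_measure_lebesgue_on lmeasurable_open)
  have "compact (f ` closure \<Omega>)"
    using continuous_on_subset[OF cont subset_UNIV] by (rule compact_continuous_image) (simp add: \<open>bounded \<Omega>\<close>)
  from compact_imp_bounded[OF this] obtain B where "\<forall>y\<in>f ` closure \<Omega>. norm y \<le> B"
    unfolding bounded_iff by blast
  then have B: "norm (f x) \<le> B" if "x \<in> \<Omega>" for x
    using that closure_subset by (meson image_eqI subsetD)
  then show ?thesis
    by (intro integrable_const_bound[where B=B] AE_I2 continuous_measurable_lebesgue_on[OF cont]) simp
qed

lemma continuous_L2:
  fixes f :: "real ^ 'n \<Rightarrow> 'b::euclidean_space"
  assumes "bounded \<Omega>" "open \<Omega>" "continuous_on UNIV f"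
  shows "f \<in> L2 \<Omega>"
  using assms unfolding L2_def
  by (auto intro!: continuous_measurable_lebesgue_on continuous_integrable_lebesgue_on continuous_intros)

lemma grad_continuous: "\<phi> \<in> test_functions \<Omega> \<Longrightarrow> continuous_on UNIV (grad \<phi>)"
  using continuous_on_vec_lambda[of UNIV "\<lambda>i x. grad \<phi> x $ i", OF test_function_grad_continuous] by simp

text \<open>The product of two test functions vanishes off the bounded set \<Omega>, so each partial
  derivative of it integrates to zero over the whole space; the product rule splits this integral
  into the two required ones.\<close>

lemma test_function_has_weak_gradient:
  fixes \<Omega> :: "(real ^ 'n) set"
  assumes \<Omega>: "bounded \<Omega>" "open \<Omega>" and \<phi>: "\<phi> \<in> test_functions \<Omega>"
  shows "has_weak_gradient \<Omega> \<phi> (grad \<phi>)"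
  unfolding has_weak_gradient_def
proof (intro conjI ballI allI)
  show "\<phi> \<in> L2 \<Omega>" using \<Omega> \<phi> by (intro continuous_L2 test_function_continuous)
  show "grad \<phi> \<in> L2 \<Omega>" using \<Omega> \<phi> by (intro continuous_L2 grad_continuous)
  fix \<psi> and i :: 'n assume \<psi>: "\<psi> \<in> test_functions \<Omega>"
  have eq: "grad (\<lambda>x. \<phi> x * \<psi> x) x $ i = \<phi> x * grad \<psi> x $ i + grad \<phi> x $ i * \<psi> x" for x
    using \<phi> \<psi> by (intro grad_mult test_function_differentiable)
  note cont = test_function_continuous[OF \<phi>] test_function_continuous[OF \<psi>]
    test_function_grad_continuous[OF \<phi>] test_function_grad_continuous[OF \<psi>]
  have "0 = (LINT x|lborel. grad (\<lambda>x. \<phi> x * \<psi> x) x $ i)"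
  proof (rule integral_grad_eq_0[symmetric])
    show "continuous_on UNIV (\<lambda>x. grad (\<lambda>x. \<phi> x * \<psi> x) x $ i)"
      unfolding eq using cont by (intro continuous_on_add continuous_on_mult)
    show "\<phi> x * \<psi> x = 0" if "x \<notin> \<Omega>" for x using that test_function_outside[OF \<phi>] by simp
  qed (use \<Omega> \<phi> \<psi> test_function_differentiable in \<open>auto intro!: differentiable_mult\<close>)
  also have "\<dots> = (LINT x|lebesgue. \<phi> x * grad \<psi> x $ i + grad \<phi> x $ i * \<psi> x)"
  proof -
    have "(\<lambda>x. \<phi> x * grad \<psi> x $ i + grad \<phi> x $ i * \<psi> x) \<in> borel_measurable borel"
      using cont by (intro borel_measurable_continuous_onI continuous_on_add continuous_on_mult)
    then show ?thesis by (subst integral_completion) (simp_all add: eq)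
  qed
  \<comment> \<open>Each summand contains an undifferentiated test function, which is zero outside
    \<Omega>.\<close>
  also have "\<dots> = (LINT x|lebesgue. indicator \<Omega> x *\<^sub>R (\<phi> x * grad \<psi> x $ i + grad \<phi> x $ i * \<psi> x))"
    using test_function_outside[OF \<phi>] test_function_outside[OF \<psi>]
    by (intro Bochner_Integration.integral_cong) (auto simp: indicator_def)
  also have "\<dots> = (LINT x|lebesgue_on \<Omega>. \<phi> x * grad \<psi> x $ i + grad \<phi> x $ i * \<psi> x)"
    using \<Omega> by (intro integral_restrict_space[symmetric]) auto
  also have "\<dots> = (LINT x|lebesgue_on \<Omega>. \<phi> x * grad \<psi> x $ i) + (LINT x|lebesgue_on \<Omega>. grad \<phi> x $ i * \<psi> x)"
    using \<Omega> cont by (intro Bochner_Integration.integral_add continuous_integrable_lebesgue_on continuous_on_mult)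
  finally show "(LINT x|lebesgue_on \<Omega>. \<phi> x * grad \<psi> x $ i) = - (LINT x|lebesgue_on \<Omega>. grad \<phi> x $ i * \<psi> x)"
    by simp
qed

section \<open>Square-integrable functions\<close>

lemma L2_integrable_inner:
  assumes "f \<in> L2 \<Omega>" "g \<in> L2 \<Omega>"
  shows "integrable (lebesgue_on \<Omega>) (\<lambda>x. f x \<bullet> g x)"
proof (rule Bochner_Integration.integrable_bound)
  show "integrable (lebesgue_on \<Omega>) (\<lambda>x. (norm (f x))\<^sup>2 + (norm (g x))\<^sup>2)"
    using assms by (auto simp: L2_def)
  show "(\<lambda>x. f x \<bullet> g x) \<in> borel_measurable (lebesgue_on \<Omega>)"
    using assms by (auto simp: L2_def)
  have "\<bar>f x \<bullet> g x\<bar> \<le> (norm (f x))\<^sup>2 + (norm (g x))\<^sup>2" for x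
  proof -
    have "\<bar>f x \<bullet> g x\<bar> \<le> norm (f x) * norm (g x)" by (rule Cauchy_Schwarz_ineq2)
    also have "\<dots> \<le> 2 * norm (f x) * norm (g x)" by simp
    also have "\<dots> \<le> (norm (f x))\<^sup>2 + (norm (g x))\<^sup>2" by (rule sum_squares_bound)
    finally show ?thesis .
  qed
  then show "AE x in lebesgue_on \<Omega>. norm (f x \<bullet> g x) \<le> norm ((norm (f x))\<^sup>2 + (norm (g x))\<^sup>2)"
    by (intro AE_I2) simp
qed

text \<open>Expanding the squared norm leaves only inner products, which are integrable. The form c
  f + g serves sums, multiples and differences alike.\<close>

lemma L2_lincomb:
  assumes "f \<in> L2 \<Omega>" "g \<in> L2 \<Omega>"
  shows "(\<lambda>x. c *\<^sub>R f x + g x) \<in> L2 \<Omega>"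
proof -
  have "(norm (c *\<^sub>R f x + g x))\<^sup>2 = c\<^sup>2 * (f x \<bullet> f x) + 2 * c * (f x \<bullet> g x) + g x \<bullet> g x" for x
    unfolding power2_norm_eq_inner
    by (simp add: algebra_simps inner_commute power2_eq_square)
  moreover have "integrable (lebesgue_on \<Omega>)
      (\<lambda>x. c\<^sup>2 * (f x \<bullet> f x) + 2 * c * (f x \<bullet> g x) + g x \<bullet> g x)"
    using assms by (intro Bochner_Integration.integrable_add integrable_mult_right L2_integrable_inner)
  ultimately show ?thesis
    using assms by (simp add: L2_def borel_measurable_add borel_measurable_scaleR)
qed

lemma L2_diff: "f \<in> L2 \<Omega> \<Longrightarrow> g \<in> L2 \<Omega> \<Longrightarrow> (\<lambda>x. f x - g x) \<in> L2 \<Omega>"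
  using L2_lincomb[of g \<Omega> f "-1"] by simp

lemma L2_zero: "(\<lambda>x. 0) \<in> L2 \<Omega>"
  by (simp add: L2_def)

lemma L2_bounded_mult:
  fixes m g :: "real ^ 'n \<Rightarrow> real"
  assumes m: "m \<in> borel_measurable (lebesgue_on \<Omega>)" and bound: "AE x in lebesgue_on \<Omega>. \<bar>m x\<bar> \<le> C"
    and g: "g \<in> L2 \<Omega>"
  shows "(\<lambda>x. m x * g x) \<in> L2 \<Omega>"
proof -
  have "integrable (lebesgue_on \<Omega>) (\<lambda>x. (norm (m x * g x))\<^sup>2)"
  proof (rule Bochner_Integration.integrable_bound)
    show "integrable (lebesgue_on \<Omega>) (\<lambda>x. C\<^sup>2 * (norm (g x))\<^sup>2)"
      using g by (auto simp: L2_def)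
    show "(\<lambda>x. (norm (m x * g x))\<^sup>2) \<in> borel_measurable (lebesgue_on \<Omega>)"
      using m g by (auto simp: L2_def)
    show "AE x in lebesgue_on \<Omega>. norm ((norm (m x * g x))\<^sup>2) \<le> norm (C\<^sup>2 * (norm (g x))\<^sup>2)"
      using bound
    proof eventually_elim
      case (elim x)
      then have "(m x)\<^sup>2 \<le> C\<^sup>2" by (simp add: abs_le_square_iff[symmetric])
      then show ?case by (simp add: power_mult_distrib mult_right_mono)
    qed
  qed
  then show ?thesis using m g by (simp add: L2_def borel_measurable_times)
qed

lemma L2_vecI:
  fixes f :: "real ^ 'n \<Rightarrow> real ^ 'm"
  assumes "\<And>i. (\<lambda>x. f x $ i) \<in> L2 \<Omega>"
  shows "f \<in> L2 \<Omega>"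
proof -
  have "f \<in> borel_measurable (lebesgue_on \<Omega>)"
    using assms by (subst borel_measurable_euclidean_space) (auto simp: Basis_vec_def inner_axis L2_def)
  moreover have "(norm (f x))\<^sup>2 = (\<Sum>i\<in>UNIV. (norm (f x $ i))\<^sup>2)" for x
    unfolding norm_vec_def L2_set_def by (simp add: sum_nonneg)
  ultimately show ?thesis using assms by (simp add: L2_def)
qed

lemma L2_nth:
  fixes f :: "real ^ 'n \<Rightarrow> real ^ 'm"
  assumes "f \<in> L2 \<Omega>"
  shows "(\<lambda>x. f x $ i) \<in> L2 \<Omega>"
proof -
  have meas: "(\<lambda>x. f x $ i) \<in> borel_measurable (lebesgue_on \<Omega>)"
    using assms borel_measurable_inner[of f "lebesgue_on \<Omega>" "\<lambda>x. axis i 1"]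
    by (simp add: L2_def inner_axis)
  have "integrable (lebesgue_on \<Omega>) (\<lambda>x. (norm (f x $ i))\<^sup>2)"
  proof (rule Bochner_Integration.integrable_bound)
    show "integrable (lebesgue_on \<Omega>) (\<lambda>x. (norm (f x))\<^sup>2)" using assms by (simp add: L2_def)
    show "AE x in lebesgue_on \<Omega>. norm ((norm (f x $ i))\<^sup>2) \<le> norm ((norm (f x))\<^sup>2)"
      by (intro AE_I2) (simp add: power_mono component_le_norm_cart abs_le_square_iff[symmetric])
  qed (use meas in simp)
  then show ?thesis using meas by (simp add: L2_def)
qed

lemma L2_sum:
  fixes f :: "'i \<Rightarrow> real ^ 'n \<Rightarrow> 'b::euclidean_space"
  assumes "finite A" "\<And>i. i \<in> A \<Longrightarrow> f i \<in> L2 \<Omega>"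
  shows "(\<lambda>x. \<Sum>i\<in>A. f i x) \<in> L2 \<Omega>"
  using assms
proof (induction A rule: finite_induct)
  case (insert i A)
  then show ?case using L2_lincomb[of "f i" \<Omega> "\<lambda>x. \<Sum>i\<in>A. f i x" 1] by simp
qed (simp add: L2_zero)

text \<open>Each component is a finite sum of essentially bounded entries times square-integrable
  components.\<close>

lemma conductivity_mult_L2:
  assumes "conductivity \<Omega> a" and G: "G \<in> L2 \<Omega>"
  shows "(\<lambda>x. a x *v G x) \<in> L2 \<Omega>"
proof (rule L2_vecI)
  fix i
  have "(\<lambda>x. a x $ i $ j * G x $ j) \<in> L2 \<Omega>" for j
  proof -
    obtain C where "AE x in lebesgue_on \<Omega>. \<bar>a x $ i $ j\<bar> \<le> C"
      using assms(1) unfolding conductivity_def by blast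
    then show ?thesis
      using assms(1) L2_nth[OF G] unfolding conductivity_def by (intro L2_bounded_mult) auto
  qed
  then show "(\<lambda>x. (a x *v G x) $ i) \<in> L2 \<Omega>"
    unfolding matrix_vector_mult_def by (simp add: L2_sum)
qed

section \<open>Orthogonality to potential fields\<close>

text \<open>\<open>L2pot\<close> is the closure of the gradients of test functions. Replacing
  \<open>q\<close> by a gradient within \<open>e\<close> leaves a remainder \<open>r\<close>, whose
  integral against \<open>w\<close> is of order \<open>e\<close>.\<close>

lemma orthogonal_L2pot:
  assumes \<Omega>: "bounded \<Omega>" "open \<Omega>" and w: "w \<in> L2 \<Omega>"
    and orth: "\<And>g. g \<in> test_functions \<Omega> \<Longrightarrow> (LINT x|lebesgue_on \<Omega>. w x \<bullet> grad g x) = 0"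
    and q: "q \<in> L2pot \<Omega>"
  shows "(LINT x|lebesgue_on \<Omega>. w x \<bullet> q x) = 0"
proof -
  define A where "A = (LINT x|lebesgue_on \<Omega>. (norm (w x))\<^sup>2)"
  have qL2: "q \<in> L2 \<Omega>" using q by (simp add: L2pot_def)
  have bound: "\<bar>LINT x|lebesgue_on \<Omega>. w x \<bullet> q x\<bar> \<le> e * (A + 1)" if "e > 0" for e
  proof -
    obtain g where g: "g \<in> test_functions \<Omega>" "L2norm \<Omega> (q - grad g) < e"
      using q \<open>e > 0\<close> by (auto simp: L2pot_def)
    have gL2: "grad g \<in> L2 \<Omega>" using \<Omega> g(1) by (intro continuous_L2 grad_continuous)
    define r where "r x = q x - grad g x" for x
    have r: "r \<in> L2 \<Omega>" unfolding r_def using qL2 gL2 by (rule L2_diff)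
    have "(LINT x|lebesgue_on \<Omega>. (norm (r x))\<^sup>2) \<ge> 0" by (intro integral_nonneg_AE) simp
    then have "(LINT x|lebesgue_on \<Omega>. (norm (r x))\<^sup>2) = (L2norm \<Omega> (q - grad g))\<^sup>2"
      by (simp add: L2norm_def r_def)
    also have "\<dots> \<le> e\<^sup>2" using g(2) by (intro power_mono) (simp_all add: L2norm_def)
    finally have r2: "(LINT x|lebesgue_on \<Omega>. (norm (r x))\<^sup>2) \<le> e\<^sup>2" .
    have "(LINT x|lebesgue_on \<Omega>. w x \<bullet> q x) = (LINT x|lebesgue_on \<Omega>. w x \<bullet> r x + w x \<bullet> grad g x)"
      by (simp add: r_def inner_diff_right)
    also have "\<dots> = (LINT x|lebesgue_on \<Omega>. w x \<bullet> r x)"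
      using L2_integrable_inner[OF w r] L2_integrable_inner[OF w gL2] orth[OF g(1)] by simp
    finally have "\<bar>LINT x|lebesgue_on \<Omega>. w x \<bullet> q x\<bar> \<le> (LINT x|lebesgue_on \<Omega>. \<bar>w x \<bullet> r x\<bar>)"
      by simp
    also have "\<dots> \<le> (LINT x|lebesgue_on \<Omega>. e * (norm (w x))\<^sup>2 + (norm (r x))\<^sup>2 / e)"
    proof (rule integral_mono)
      \<comment> \<open>Young's inequality with weight \<open>e\<close>: as the integral of the
        squared norm of \<open>r\<close> is at most \<open>e\<^sup>2\<close>, both terms integrate
        to multiples of \<open>e\<close>. This pointwise bound takes the place of the Cauchy-Schwarz
        inequality for integrals.\<close>
      show "\<bar>w x \<bullet> r x\<bar> \<le> e * (norm (w x))\<^sup>2 + (norm (r x))\<^sup>2 / e" for x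
      proof -
        have "\<bar>w x \<bullet> r x\<bar> \<le> norm (w x) * norm (r x)" by (rule Cauchy_Schwarz_ineq2)
        also have "\<dots> \<le> 2 * norm (w x) * norm (r x)" by simp
        also have "\<dots> = 2 * (e * norm (w x)) * norm (r x) / e" using \<open>e > 0\<close> by simp
        also have "\<dots> \<le> ((e * norm (w x))\<^sup>2 + (norm (r x))\<^sup>2) / e"
          using \<open>e > 0\<close> by (intro divide_right_mono sum_squares_bound) simp
        also have "\<dots> = e * (norm (w x))\<^sup>2 + (norm (r x))\<^sup>2 / e"
          using \<open>e > 0\<close> by (simp add: add_divide_distrib power2_eq_square)
        finally show ?thesis .
      qed
    next
      show "integrable (lebesgue_on \<Omega>) (\<lambda>x. \<bar>w x \<bullet> r x\<bar>)"
        using L2_integrable_inner[OF w r] by (rule integrable_abs)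
      show "integrable (lebesgue_on \<Omega>) (\<lambda>x. e * (norm (w x))\<^sup>2 + (norm (r x))\<^sup>2 / e)"
        using w r by (simp add: L2_def)
    qed
    also have "\<dots> = e * A + (LINT x|lebesgue_on \<Omega>. (norm (r x))\<^sup>2) / e"
      using w r by (simp add: L2_def A_def)
    also have "\<dots> \<le> e * A + e\<^sup>2 / e"
      using r2 \<open>e > 0\<close> by (intro add_left_mono divide_right_mono) auto
    also have "\<dots> = e * (A + 1)" using \<open>e > 0\<close> by (simp add: power2_eq_square distrib_left)
    finally show ?thesis .
  qed
  have "A \<ge> 0" unfolding A_def by (intro integral_nonneg_AE) simp
  have "\<bar>LINT x|lebesgue_on \<Omega>. w x \<bullet> q x\<bar> \<le> 0"
  proof (rule field_le_epsilon)
    show "\<bar>LINT x|lebesgue_on \<Omega>. w x \<bullet> q x\<bar> \<le> 0 + e" if "e > 0" for e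
      using bound[of "e / (A + 1)"] that \<open>A \<ge> 0\<close> by simp
  qed
  then show ?thesis by simp
qed

section \<open>Weak gradients and fluxes\<close>

text \<open>Each component of G - H integrates to zero against every test function, so the
  fundamental lemma applies componentwise.\<close>

lemma weak_gradient_unique:
  fixes \<Omega> :: "(real ^ 'n) set"
  assumes \<Omega>: "bounded \<Omega>" "open \<Omega>"
    and G: "has_weak_gradient \<Omega> u G" and H: "has_weak_gradient \<Omega> u H"
  shows "AE x in lebesgue_on \<Omega>. G x = H x"
proof -
  have "AE x in lebesgue_on \<Omega>. G x $ i - H x $ i = 0" for i
  proof (rule fundamental_lemma_of_variations)
    have int: "integrable (lebesgue_on \<Omega>) (\<lambda>x. K x $ i * \<phi> x)"
      if "K \<in> L2 \<Omega>" "continuous_on UNIV \<phi>"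
      for K :: "real ^ 'n \<Rightarrow> real ^ 'n" and \<phi> :: "real ^ 'n \<Rightarrow> real"
      using L2_integrable_inner[OF L2_nth[OF that(1)] continuous_L2[OF \<Omega> that(2)], of i] by simp
    have L2: "G \<in> L2 \<Omega>" "H \<in> L2 \<Omega>" using G H by (auto simp: has_weak_gradient_def)
    show "integrable (lebesgue_on \<Omega>) (\<lambda>x. G x $ i - H x $ i)"
      \<comment> \<open>On the bounded \<Omega> the constant 1 is square-integrable, which makes
        square-integrable functions integrable.\<close>
      using int[OF L2(1), of "\<lambda>_. 1"] int[OF L2(2), of "\<lambda>_. 1"] by simp
    fix \<phi> assume \<phi>: "\<phi> \<in> test_functions \<Omega>"
    have "(LINT x|lebesgue_on \<Omega>. (G x $ i - H x $ i) * \<phi> x)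
        = (LINT x|lebesgue_on \<Omega>. G x $ i * \<phi> x) - (LINT x|lebesgue_on \<Omega>. H x $ i * \<phi> x)"
      using int[OF L2(1) test_function_continuous[OF \<phi>]] int[OF L2(2) test_function_continuous[OF \<phi>]]
      by (simp add: left_diff_distrib)
    also have "\<dots> = 0"
    proof -
      have "(LINT x|lebesgue_on \<Omega>. u x * grad \<phi> x $ i) = - (LINT x|lebesgue_on \<Omega>. G x $ i * \<phi> x)"
           "(LINT x|lebesgue_on \<Omega>. u x * grad \<phi> x $ i) = - (LINT x|lebesgue_on \<Omega>. H x $ i * \<phi> x)"
        using G H \<phi> unfolding has_weak_gradient_def by blast+
      then show ?thesis by simp
    qed
    finally show "(LINT x|lebesgue_on \<Omega>. (G x $ i - H x $ i) * \<phi> x) = 0" .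
  qed (rule \<Omega>)
  then have "AE x in lebesgue_on \<Omega>. \<forall>i\<in>UNIV. G x $ i - H x $ i = 0"
    by (intro AE_finite_allI) auto
  then show ?thesis by eventually_elim (simp add: vec_eq_iff)
qed

lemma has_weak_gradient_wgrad: "u \<in> H1 \<Omega> \<Longrightarrow> has_weak_gradient \<Omega> u (wgrad \<Omega> u)"
  using someI_ex[of "has_weak_gradient \<Omega> u"] by (simp add: H1_def wgrad_def)

lemma wgrad_L2: "u \<in> H1 \<Omega> \<Longrightarrow> wgrad \<Omega> u \<in> L2 \<Omega>"
  using has_weak_gradient_wgrad by (auto simp: has_weak_gradient_def)

text \<open>Removes the dependence on the choice behind \<open>wgrad\<close>: any explicitly known
  weak gradient may replace it under an integral.\<close>

lemma wgrad_eq: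
  assumes "bounded \<Omega>" "open \<Omega>" "has_weak_gradient \<Omega> u G"
  shows "AE x in lebesgue_on \<Omega>. wgrad \<Omega> u x = G x"
  using assms weak_gradient_unique has_weak_gradient_wgrad unfolding H1_def by blast

lemma has_weak_gradient_lincomb:
  assumes \<Omega>: "bounded \<Omega>" "open \<Omega>"
    and u: "has_weak_gradient \<Omega> u G" and v: "has_weak_gradient \<Omega> v H"
  shows "has_weak_gradient \<Omega> (c *\<^sub>R u + v) (\<lambda>x. c *\<^sub>R G x + H x)"
  unfolding has_weak_gradient_def
proof (intro conjI ballI allI)
  have L2: "u \<in> L2 \<Omega>" "G \<in> L2 \<Omega>" "v \<in> L2 \<Omega>" "H \<in> L2 \<Omega>"
    using u v by (auto simp: has_weak_gradient_def)
  have uv: "c *\<^sub>R u + v = (\<lambda>x. c *\<^sub>R u x + v x)"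
    by (simp add: fun_eq_iff scaleR_fun_def)
  show "c *\<^sub>R u + v \<in> L2 \<Omega>" unfolding uv using L2 by (intro L2_lincomb)
  show "(\<lambda>x. c *\<^sub>R G x + H x) \<in> L2 \<Omega>" using L2 by (intro L2_lincomb)
  fix \<phi> i assume \<phi>: "\<phi> \<in> test_functions \<Omega>"
  have int: "integrable (lebesgue_on \<Omega>) (\<lambda>x. f x * g x)"
    if "f \<in> L2 \<Omega>" "continuous_on UNIV g" for f g :: "real ^ 'a \<Rightarrow> real"
    using L2_integrable_inner[OF that(1) continuous_L2[OF \<Omega> that(2)]] by simp
  note cont = test_function_continuous[OF \<phi>] test_function_grad_continuous[OF \<phi>]
  have "(LINT x|lebesgue_on \<Omega>. (c *\<^sub>R u + v) x * grad \<phi> x $ i)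
      = (LINT x|lebesgue_on \<Omega>. c * (u x * grad \<phi> x $ i) + v x * grad \<phi> x $ i)"
    unfolding uv by (simp add: algebra_simps)
  also have "\<dots> = c * (LINT x|lebesgue_on \<Omega>. u x * grad \<phi> x $ i) + (LINT x|lebesgue_on \<Omega>. v x * grad \<phi> x $ i)"
    using int[OF L2(1) cont(2)] int[OF L2(3) cont(2)] by simp
  also have "\<dots> = c * - (LINT x|lebesgue_on \<Omega>. G x $ i * \<phi> x) + - (LINT x|lebesgue_on \<Omega>. H x $ i * \<phi> x)"
    using u v \<phi> by (simp add: has_weak_gradient_def)
  also have "\<dots> = - (LINT x|lebesgue_on \<Omega>. c * (G x $ i * \<phi> x) + H x $ i * \<phi> x)"
    using int[OF L2_nth[OF L2(2)] cont(1)] int[OF L2_nth[OF L2(4)] cont(1)] by simp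
  also have "\<dots> = - (LINT x|lebesgue_on \<Omega>. (c *\<^sub>R G x + H x) $ i * \<phi> x)"
    by (simp add: algebra_simps)
  finally show "(LINT x|lebesgue_on \<Omega>. (c *\<^sub>R u + v) x * grad \<phi> x $ i)
      = - (LINT x|lebesgue_on \<Omega>. (c *\<^sub>R G x + H x) $ i * \<phi> x)" .
qed

lemma H1_lincomb:
  assumes "bounded \<Omega>" "open \<Omega>" "u \<in> H1 \<Omega>" "v \<in> H1 \<Omega>"
  shows "c *\<^sub>R u + v \<in> H1 \<Omega>"
  using assms has_weak_gradient_lincomb unfolding H1_def by blast

text \<open>A test function approximates itself. What remains is that \<open>wgrad\<close> of the
  zero function, being an arbitrary choice, vanishes almost everywhere and so has norm zero.\<close>

lemma test_function_H10:
  assumes \<Omega>: "bounded \<Omega>" "open \<Omega>" and \<phi>: "\<phi> \<in> test_functions \<Omega>"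
  shows "\<phi> \<in> H10 \<Omega>"
proof -
  have "has_weak_gradient \<Omega> (0 :: real ^ 'a \<Rightarrow> real) (\<lambda>x. 0)"
    by (simp add: has_weak_gradient_def L2_zero zero_fun_def)
  then have "AE x in lebesgue_on \<Omega>. wgrad \<Omega> 0 x = 0" using \<Omega> by (intro wgrad_eq)
  then have "L2norm \<Omega> (wgrad \<Omega> 0) = 0"
    by (auto simp: L2norm_def intro!: integral_eq_zero_AE elim!: eventually_mono)
  then have "H1norm \<Omega> (\<phi> - \<phi>) = 0" by (simp add: H1norm_def L2norm_def)
  moreover have "\<phi> \<in> H1 \<Omega>"
    using test_function_has_weak_gradient[OF assms] by (auto simp: H1_def)
  ultimately show ?thesis using \<phi> by (auto simp: H10_def intro!: bexI[of _ \<phi>])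
qed

lemma flux_L2: "conductivity \<Omega> a \<Longrightarrow> u \<in> H1 \<Omega> \<Longrightarrow> flux \<Omega> a u \<in> L2 \<Omega>"
  unfolding flux_def by (intro conductivity_mult_L2 wgrad_L2)

text \<open>The chosen weak gradients are linear only up to null sets, so linearity is stated for
  integrals of the flux against \<open>q\<close> and not for its values.\<close>

lemma integral_flux_lincomb:
  assumes \<Omega>: "bounded \<Omega>" "open \<Omega>" and a: "conductivity \<Omega> a"
    and u: "u \<in> H1 \<Omega>" and v: "v \<in> H1 \<Omega>" and q: "q \<in> L2 \<Omega>"
  shows "(LINT x|lebesgue_on \<Omega>. flux \<Omega> a (c *\<^sub>R u + v) x \<bullet> q x)
    = c * (LINT x|lebesgue_on \<Omega>. flux \<Omega> a u x \<bullet> q x) + (LINT x|lebesgue_on \<Omega>. flux \<Omega> a v x \<bullet> q x)"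
proof -
  note int = L2_integrable_inner[OF flux_L2[OF a] q]
  have "AE x in lebesgue_on \<Omega>. wgrad \<Omega> (c *\<^sub>R u + v) x = c *\<^sub>R wgrad \<Omega> u x + wgrad \<Omega> v x"
    using \<Omega> u v by (intro wgrad_eq has_weak_gradient_lincomb has_weak_gradient_wgrad)
  then have "AE x in lebesgue_on \<Omega>. flux \<Omega> a (c *\<^sub>R u + v) x \<bullet> q x
      = c * (flux \<Omega> a u x \<bullet> q x) + flux \<Omega> a v x \<bullet> q x"
    by eventually_elim
      (simp add: flux_def matrix_vector_right_distrib matrix_vector_mult_scaleR inner_add_left)
  then have "(LINT x|lebesgue_on \<Omega>. flux \<Omega> a (c *\<^sub>R u + v) x \<bullet> q x)
      = (LINT x|lebesgue_on \<Omega>. c * (flux \<Omega> a u x \<bullet> q x) + flux \<Omega> a v x \<bullet> q x)"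
    using int[OF H1_lincomb[OF \<Omega> u v]] int[OF u] int[OF v]
    by (intro integral_cong_AE borel_measurable_integrable) auto
  then show ?thesis using int[OF u] int[OF v] by simp
qed

lemma H10_subset_H1: "H10 \<Omega> \<subseteq> H1 \<Omega>"
  by (auto simp: H10_def)

text \<open>A functional sees the flux only through integrals, so the exceptional null sets
  disappear and linearity becomes a true equation. Off \<open>H10 \<Omega>\<close> both sides are
  zero by convention.\<close>

lemma div_flux_lincomb:
  assumes "bounded \<Omega>" "open \<Omega>" "conductivity \<Omega> a" "u \<in> H1 \<Omega>" "v \<in> H1 \<Omega>"
  shows "div_flux \<Omega> a (c *\<^sub>R u + v) = c *\<^sub>R div_flux \<Omega> a u + div_flux \<Omega> a v"
proof
  fix \<phi>
  show "div_flux \<Omega> a (c *\<^sub>R u + v) \<phi> = (c *\<^sub>R div_flux \<Omega> a u + div_flux \<Omega> a v) \<phi>"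
  proof (cases "\<phi> \<in> H10 \<Omega>")
    case True
    then have "wgrad \<Omega> \<phi> \<in> L2 \<Omega>" using H10_subset_H1 wgrad_L2 by blast
    then show ?thesis
      using True integral_flux_lincomb[OF assms] by (simp add: div_flux_def scaleR_fun_def)
  qed (simp add: div_flux_def scaleR_fun_def)
qed

text \<open>The image of a subspace under a linear map is a subspace and so its own span. Hence
  every element of the divergence space comes from a single \<open>v\<close>, which is what matching
  competitors requires.\<close>

lemma div_space_eq_image:
  assumes \<Omega>: "bounded \<Omega>" "open \<Omega>" and a: "conductivity \<Omega> a"
    and V: "subspace V" "V \<subseteq> H1 \<Omega>"
  shows "div_space \<Omega> a V = div_flux \<Omega> a ` V"
proof -
  have lin: "div_flux \<Omega> a (c *\<^sub>R u + v) = c *\<^sub>R div_flux \<Omega> a u + div_flux \<Omega> a v"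
    if "u \<in> V" "v \<in> V" for c u v
    using that V(2) by (intro div_flux_lincomb \<Omega> a) auto
  have zero: "0 \<in> V" using V(1) by (rule subspace_0)
  \<comment> \<open>With \<open>c = -1\<close> and both functions zero, linearity reads div 0 = -
    div 0 + div 0, which is zero.\<close>
  have div0: "div_flux \<Omega> a 0 = 0" using lin[OF zero zero, of "-1"] by simp
  have "subspace (div_flux \<Omega> a ` V)"
  proof (rule subspaceI)
    show "0 \<in> div_flux \<Omega> a ` V" using zero div0 by (metis imageI)
  next
    fix x y assume "x \<in> div_flux \<Omega> a ` V" "y \<in> div_flux \<Omega> a ` V"
    then obtain u v where uv: "u \<in> V" "v \<in> V" "x = div_flux \<Omega> a u" "y = div_flux \<Omega> a v" by blast
    then have "x + y = div_flux \<Omega> a (u + v)" using lin[of u v 1] by simp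
    then show "x + y \<in> div_flux \<Omega> a ` V" using uv V(1) subspace_add by blast
  next
    fix c x assume "x \<in> div_flux \<Omega> a ` V"
    then obtain u where u: "u \<in> V" "x = div_flux \<Omega> a u" by blast
    then have "c *\<^sub>R x = div_flux \<Omega> a (c *\<^sub>R u)" using lin[OF u(1) zero, of c] div0 by simp
    then show "c *\<^sub>R x \<in> div_flux \<Omega> a ` V" using u V(1) subspace_scale by blast
  qed
  then show ?thesis unfolding div_space_def by (simp add: span_eq_iff)
qed

section \<open>Comparison of the two approximation problems\<close>

text \<open>Tested with the gradient of \<phi>, either flux yields the integral of f \<phi> plus the
  value at \<phi> of the divergence functional of \<open>v\<close> or \<open>v'\<close>. The source
  \<open>f\<close> is shared and the functionals agree by \<open>div\<close>, so the conductivities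
  drop out.\<close>

lemma flux_norm_eq:
  assumes \<Omega>: "bounded \<Omega>" "open \<Omega>"
    and a: "conductivity \<Omega> a" and a': "conductivity \<Omega> a'"
    and u: "weak_solution \<Omega> a f u" and u': "weak_solution \<Omega> a' f u'"
    and v: "v \<in> H1 \<Omega>" and v': "v' \<in> H1 \<Omega>" and div: "div_flux \<Omega> a v = div_flux \<Omega> a' v'"
  shows "flux_norm \<Omega> a (u - v) = flux_norm \<Omega> a' (u' - v')"
proof -
  have uH: "u \<in> H1 \<Omega>" "u' \<in> H1 \<Omega>" using u u' H10_subset_H1 by (auto simp: weak_solution_def)
  have minus: "u - v = (-1) *\<^sub>R v + u" "u' - v' = (-1) *\<^sub>R v' + u'" by simp_all
  have H: "u - v \<in> H1 \<Omega>" "u' - v' \<in> H1 \<Omega>"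
    unfolding minus using \<Omega> uH v v' by (simp_all only: H1_lincomb)
  define k k' where "k = flux \<Omega> a (u - v)" and "k' = flux \<Omega> a' (u' - v')"
  have k: "k \<in> L2 \<Omega>" "k' \<in> L2 \<Omega>"
    unfolding k_def k'_def using flux_L2 a a' H by blast+
  have test: "(LINT x|lebesgue_on \<Omega>. k x \<bullet> grad \<phi> x) = (LINT x|lebesgue_on \<Omega>. k' x \<bullet> grad \<phi> x)"
    if \<phi>: "\<phi> \<in> test_functions \<Omega>" for \<phi>
  proof -
    have \<phi>H: "\<phi> \<in> H10 \<Omega>" using \<Omega> \<phi> by (rule test_function_H10)
    have g: "wgrad \<Omega> \<phi> \<in> L2 \<Omega>" "grad \<phi> \<in> L2 \<Omega>"
      using \<phi>H H10_subset_H1 wgrad_L2 continuous_L2[OF \<Omega> grad_continuous[OF \<phi>]] by blast+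
    have AE: "AE x in lebesgue_on \<Omega>. wgrad \<Omega> \<phi> x = grad \<phi> x"
      using \<Omega> test_function_has_weak_gradient[OF \<Omega> \<phi>] by (rule wgrad_eq)
    \<comment> \<open>Weak solutions are tested with \<open>wgrad\<close>, the closure in
      \<open>L2pot\<close> is taken over classical gradients; the two agree almost everywhere for a
      test function.\<close>
    have swap: "(LINT x|lebesgue_on \<Omega>. j x \<bullet> grad \<phi> x) = (LINT x|lebesgue_on \<Omega>. j x \<bullet> wgrad \<Omega> \<phi> x)"
      if "j \<in> L2 \<Omega>" for j
      using AE L2_integrable_inner[OF that g(1)] L2_integrable_inner[OF that g(2)]
      by (intro integral_cong_AE borel_measurable_integrable) (auto elim!: eventually_mono)
    have eq: "(LINT x|lebesgue_on \<Omega>. flux \<Omega> b (w - z) x \<bullet> wgrad \<Omega> \<phi> x)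
        = (LINT x|lebesgue_on \<Omega>. f x * \<phi> x) + div_flux \<Omega> b z \<phi>"
      if "conductivity \<Omega> b" "weak_solution \<Omega> b f w" "z \<in> H1 \<Omega>" for b w z
    proof -
      have w: "w \<in> H1 \<Omega>" using that(2) H10_subset_H1 by (auto simp: weak_solution_def)
      have "(LINT x|lebesgue_on \<Omega>. flux \<Omega> b w x \<bullet> wgrad \<Omega> \<phi> x) = (LINT x|lebesgue_on \<Omega>. f x * \<phi> x)"
        using that(2) \<phi>H by (simp add: weak_solution_def)
      then show ?thesis
        using integral_flux_lincomb[OF \<Omega> that(1,3) w g(1), of "-1"] \<phi>H by (simp add: div_flux_def)
    qed
    show ?thesis
      unfolding swap[OF k(1)] swap[OF k(2)] unfolding k_def k'_def eq[OF a u v] eq[OF a' u' v'] div ..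
  qed
  \<comment> \<open>The two sides differ by the integral of (k - k') against \<open>q\<close>, which
    is zero by orthogonality; membership in \<open>L2\<close> of all four functions permits
    splitting the integrals.\<close>
  have proj: "(LINT x|lebesgue_on \<Omega>. (k x - p x) \<bullet> q x) = (LINT x|lebesgue_on \<Omega>. (k' x - p x) \<bullet> q x)"
    if p: "p \<in> L2pot \<Omega>" and q: "q \<in> L2pot \<Omega>" for p q
  proof -
    have L2: "p \<in> L2 \<Omega>" "q \<in> L2 \<Omega>" using p q by (auto simp: L2pot_def)
    have "(LINT x|lebesgue_on \<Omega>. (k x - k' x) \<bullet> q x) = 0"
    proof (rule orthogonal_L2pot[OF \<Omega> _ _ q])
      fix g assume g: "g \<in> test_functions \<Omega>"
      have gL2: "grad g \<in> L2 \<Omega>" using continuous_L2[OF \<Omega> grad_continuous[OF g]] .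
      show "(LINT x|lebesgue_on \<Omega>. (k x - k' x) \<bullet> grad g x) = 0"
        using test[OF g] L2_integrable_inner[OF k(1) gL2] L2_integrable_inner[OF k(2) gL2]
        by (simp add: inner_diff_left)
    qed (rule L2_diff[OF k])
    then show ?thesis
      using L2_integrable_inner[OF k(1) L2(2)] L2_integrable_inner[OF k(2) L2(2)] L2_integrable_inner[OF L2]
      by (simp add: inner_diff_left)
  qed
  have "pot \<Omega> k = pot \<Omega> k'"
    unfolding pot_def using proj by (intro arg_cong[of _ _ Eps] ext) (metis (no_types, lifting))
  then show ?thesis by (simp add: flux_norm_def k_def k'_def)
qed

text \<open>Every competitor in \<open>V\<close> has a partner in \<open>V'\<close> with exactly the
  same value. The hypotheses are symmetric in the two problems, so one inequality gives both;
  \<open>c\<close> stands for the common norm of \<open>f\<close>.\<close>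

lemma INF_flux_norm_le:
  assumes \<Omega>: "bounded \<Omega>" "open \<Omega>"
    and a: "conductivity \<Omega> a" and a': "conductivity \<Omega> a'"
    and V: "subspace V" "V \<subseteq> H10 \<Omega>" and V': "subspace V'" "V' \<subseteq> H10 \<Omega>"
    and u: "weak_solution \<Omega> a f u" and u': "weak_solution \<Omega> a' f u'"
    and div: "div_space \<Omega> a V = div_space \<Omega> a' V'"
  shows "(INF v \<in> V'. ereal (flux_norm \<Omega> a' (u' - v) / c)) \<le> (INF v \<in> V. ereal (flux_norm \<Omega> a (u - v) / c))"
proof (rule INF_mono)
  fix v assume v: "v \<in> V"
  have H1: "V \<subseteq> H1 \<Omega>" "V' \<subseteq> H1 \<Omega>" using V V' H10_subset_H1 by blast+
  have "div_flux \<Omega> a v \<in> div_flux \<Omega> a' ` V'"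
    using v div div_space_eq_image[OF \<Omega> a V(1) H1(1)] div_space_eq_image[OF \<Omega> a' V'(1) H1(2)] by blast
  then obtain v' where v': "v' \<in> V'" "div_flux \<Omega> a v = div_flux \<Omega> a' v'" by blast
  then have "flux_norm \<Omega> a (u - v) = flux_norm \<Omega> a' (u' - v')"
    using v H1 by (intro flux_norm_eq[OF \<Omega> a a' u u']) auto
  then show "\<exists>w\<in>V'. ereal (flux_norm \<Omega> a' (u' - w) / c) \<le> ereal (flux_norm \<Omega> a (u - v) / c)"
    using v'(1) by auto
qed

theorem theorem2p1:
  fixes \<Omega> :: "(real ^ 'n) set"
    and a a' :: "real ^ 'n \<Rightarrow> real ^ 'n ^ 'n"
    and V V' :: "(real ^ 'n \<Rightarrow> real) set"
    and u u' :: "(real ^ 'n \<Rightarrow> real) \<Rightarrow> real ^ 'n \<Rightarrow> real"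
  assumes "CARD('n) \<ge> 2"
    and "bounded_C2_domain \<Omega>"
    and "conductivity \<Omega> a" and "conductivity \<Omega> a'"
    and "findim_subspace_H10 \<Omega> V" and "findim_subspace_H10 \<Omega> V'"
    and "\<And>f. f \<in> L2 \<Omega> \<Longrightarrow> weak_solution \<Omega> a f (u f)"
    and "\<And>f. f \<in> L2 \<Omega> \<Longrightarrow> weak_solution \<Omega> a' f (u' f)"
    and "div_space \<Omega> a V = div_space \<Omega> a' V'"
  shows "(SUP f \<in> {f \<in> L2 \<Omega>. \<not> (AE x in lebesgue_on \<Omega>. f x = 0)}.
            INF v \<in> V. ereal (flux_norm \<Omega> a (u f - v) / L2norm \<Omega> f)) =
         (SUP f \<in> {f \<in> L2 \<Omega>. \<not> (AE x in lebesgue_on \<Omega>. f x = 0)}.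
            INF v \<in> V'. ereal (flux_norm \<Omega> a' (u' f - v) / L2norm \<Omega> f))"
proof (rule SUP_cong[OF refl])
  fix f :: "real ^ 'n \<Rightarrow> real"
  assume f: "f \<in> {f \<in> L2 \<Omega>. \<not> (AE x in lebesgue_on \<Omega>. f x = 0)}"
  have \<Omega>: "bounded \<Omega>" "open \<Omega>" using assms(2) by (auto simp: bounded_C2_domain_def)
  have V: "subspace V" "V \<subseteq> H10 \<Omega>" and V': "subspace V'" "V' \<subseteq> H10 \<Omega>"
    using assms(5,6) by (auto simp: findim_subspace_H10_def)
  have u: "weak_solution \<Omega> a f (u f)" and u': "weak_solution \<Omega> a' f (u' f)"
    using f assms(7,8) by auto
  show "(INF v \<in> V. ereal (flux_norm \<Omega> a (u f - v) / L2norm \<Omega> f)) =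
        (INF v \<in> V'. ereal (flux_norm \<Omega> a' (u' f - v) / L2norm \<Omega> f))"
    \<comment> \<open>The second instance exchanges the roles of the two problems.\<close>
    using INF_flux_norm_le[OF \<Omega> assms(3,4) V V' u u' assms(9)]
      INF_flux_norm_le[OF \<Omega> assms(4,3) V' V u' u assms(9)[symmetric]]
    by (rule antisym[rotated])
qed

end
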